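(* Let $A=\log L\in L(\ell_2)$ be the bounded operator on $\mathbb{X}=\ell_2$ defined in the context (with parameters $a,\nu$ satisfying $0<a<1$, $0<\nu<\min\{a,1-a\}$ and $0<-\log(1-\frac{\nu}{a})<\frac a2$). Consider the systems $$\text{(i)}\ \ \dot x=Ax,\qquad \text{(ii)}\ \ \dot y=Ay+B(\omega t)y,$$ where $B:\mathbb{R}\to L(\ell_2)$ is a generalized almost periodic function with mean value zero. Let $M>0$ be such that $\|A\|\le M$ and $\sup_{t\in\mathbb{R}}\|B(t)\|\le M$. Let $S_\omega(t,s)=Y(t)Y^{-1}(s)$ be the evolution operator associated to system (ii), where $Y(t)$ is the operator solution of (ii) with initial condition $Y(0)=I$, the identity operator. Then there exist $\tilde K>0$, $\tilde\alpha>0$ and $\omega_0>0$ such that for every $\omega>\omega_0$ $$\|S_\omega(t,s)\|\le\tilde Ke^{-\tilde\alpha(t-s)},\qquad t\ge s .$$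
   Context: $L(\mathbb{X})$ denotes the bounded linear operators on $\mathbb{X}$ with the operator norm. The operator $A$: let $J$ be the right shift on $\ell_2$, i.e. the infinite matrix with ones on the first subdiagonal and zeros elsewhere ($Je_n=e_{n+1}$, $n\ge1$). Define on $\ell_2$, written as the direct sum of its first coordinate and the remaining coordinates (again identified with $\ell_2$), the operator $$L=\begin{pmatrix}a&0\\0&\nu J+aI\end{pmatrix}=a(I-D),\qquad D=\Big(\frac{-\nu}{a}\Big)\begin{pmatrix}0&0\\0&J\end{pmatrix},$$ where $0<a<1$, $0<\nu<\min\{a,1-a\}$, and $\nu$ is small enough that $0<-\log(1-\frac\nu a)<\frac a2$. Then $A=\log L=(\log a)I+\log(I-D)$, where $\log(I-D)=-\sum_{n\ge1}\frac{D^n}{n}$. Generalized almost periodic functions: let $\mathcal{F}$ be the set of bounded, uniformly continuous functions $B:\mathbb{R}\to L(\mathbb{X})$ whose range is precompact in $L(\mathbb{X})$. A function $B\in\mathcal{F}$ is generalized almost periodic if there exists $\mathbf{B}\in L(\mathbb{X})$ such that for every $\varepsilon>0$ there is $T_0>0$ with $\big\|\frac1T\int_a^{a+T}B(t)\,dt-\mathbf{B}\big\|<\varepsilon$ for every $T\ge T_0$ and every $a\in\mathbb{R}$. The operator $\mathbf{B}$ is called the mean value of $B$. *)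

theory Defs
  imports "HOL-Analysis.Analysis"
begin

definition square_summable :: "(nat \<Rightarrow> 'a::real_normed_vector) \<Rightarrow> bool" where
  "square_summable f \<longleftrightarrow> summable (\<lambda>n. (norm (f n))\<^sup>2)"

lemma square_summable_L2_set_le:
  assumes "square_summable f"
  shows "L2_set (\<lambda>n. norm (f n)) {..<k} \<le> sqrt (\<Sum>n. (norm (f n))\<^sup>2)"
  unfolding L2_set_def
  using assms by (intro real_sqrt_le_mono sum_le_suminf) (auto simp: square_summable_def)

lemma square_summable_bounded:
  assumes le: "\<And>k. L2_set (\<lambda>n. norm (f n)) {..<k} \<le> c"
  shows "square_summable f" and "sqrt (\<Sum>n. (norm (f n))\<^sup>2) \<le> c"
proof -
  have c: "0 \<le> c"
    using le[of 0] by simp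
  have *: "(\<Sum>n<k. (norm (f n))\<^sup>2) \<le> c\<^sup>2" for k
    using le[of k] c unfolding L2_set_def by (simp add: real_sqrt_le_iff' sum_nonneg)
  have s: "summable (\<lambda>n. (norm (f n))\<^sup>2)"
    by (rule bounded_imp_summable[where B="c\<^sup>2"])
       (use *[of "Suc k" for k] in \<open>auto simp: lessThan_Suc_atMost\<close>)
  then show "square_summable f"
    by (simp add: square_summable_def)
  have "(\<Sum>n. (norm (f n))\<^sup>2) \<le> c\<^sup>2"
    by (rule suminf_le_const[OF s]) (rule *)
  then show "sqrt (\<Sum>n. (norm (f n))\<^sup>2) \<le> c"
    using c real_le_lsqrt by blast
qed

lemma L2_set_norm_add_le:
  "L2_set (\<lambda>n. norm (f n + g n)) A \<le> L2_set (\<lambda>n. norm (f n)) A + L2_set (\<lambda>n. norm (g n)) A"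
proof -
  have "L2_set (\<lambda>n. norm (f n + g n)) A \<le> L2_set (\<lambda>n. norm (f n) + norm (g n)) A"
    by (rule L2_set_mono) (auto simp: norm_triangle_ineq)
  also have "\<dots> \<le> L2_set (\<lambda>n. norm (f n)) A + L2_set (\<lambda>n. norm (g n)) A"
    by (rule L2_set_triangle_ineq)
  finally show ?thesis .
qed

lemma
  assumes f: "square_summable f" and g: "square_summable g"
  shows square_summable_add: "square_summable (\<lambda>n. f n + g n)"
    and square_summable_norm_add: "sqrt (\<Sum>n. (norm (f n + g n))\<^sup>2)
       \<le> sqrt (\<Sum>n. (norm (f n))\<^sup>2) + sqrt (\<Sum>n. (norm (g n))\<^sup>2)"
proof -
  have le: "L2_set (\<lambda>n. norm (f n + g n)) {..<k}
       \<le> sqrt (\<Sum>n. (norm (f n))\<^sup>2) + sqrt (\<Sum>n. (norm (g n))\<^sup>2)" for k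
    using L2_set_norm_add_le[of f g "{..<k}"] square_summable_L2_set_le[OF f, of k]
      square_summable_L2_set_le[OF g, of k] by linarith
  show "square_summable (\<lambda>n. f n + g n)"
    using le by (rule square_summable_bounded(1))
  show "sqrt (\<Sum>n. (norm (f n + g n))\<^sup>2)
       \<le> sqrt (\<Sum>n. (norm (f n))\<^sup>2) + sqrt (\<Sum>n. (norm (g n))\<^sup>2)"
    using le by (rule square_summable_bounded(2))
qed

lemma square_summable_scaleR: "square_summable f \<Longrightarrow> square_summable (\<lambda>n. r *\<^sub>R f n)"
  by (simp add: square_summable_def power_mult_distrib summable_mult)

lemma square_summable_uminus: "square_summable f \<Longrightarrow> square_summable (\<lambda>n. - f n)"
  by (simp add: square_summable_def)

lemma square_summable_diff:
  "square_summable f \<Longrightarrow> square_summable g \<Longrightarrow> square_summable (\<lambda>n. f n - g n)"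
  using square_summable_add[OF _ square_summable_uminus, of f g] by simp

text \<open>The coordinate type \<open>'a\<close> plays the role of the scalar field. The complete real normed fields
  are, up to isomorphism, the real and the complex numbers, so that both real and complex \<open>\<ell>\<^sub>2\<close> are
  covered. Elements of the type \<open>'a ell2 \<Rightarrow>\<^sub>L 'a ell2\<close> are real-linear; over the complex numbers the
  complex-linear operators form a closed subspace of it, with the same operator norm.\<close>

typedef (overloaded) ('a::real_normed_vector) ell2 = "{f :: nat \<Rightarrow> 'a. square_summable f}"
  morphisms coord Abs_ell2
  by (rule exI[of _ "\<lambda>_. 0"]) (simp add: square_summable_def)

setup_lifting type_definition_ell2

lemma ell2_eqI: "(\<And>n. coord x n = coord y n) \<Longrightarrow> x = y"
  by transfer auto

lemma square_summable_coord: "square_summable (coord x)"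
  by transfer auto

instantiation ell2 :: (real_normed_vector) real_normed_vector
begin

lift_definition zero_ell2 :: "'a ell2" is "\<lambda>_. 0"
  by (simp add: square_summable_def)
lift_definition plus_ell2 :: "'a ell2 \<Rightarrow> 'a ell2 \<Rightarrow> 'a ell2" is "\<lambda>f g n. f n + g n"
  by (rule square_summable_add)
lift_definition minus_ell2 :: "'a ell2 \<Rightarrow> 'a ell2 \<Rightarrow> 'a ell2" is "\<lambda>f g n. f n - g n"
  by (rule square_summable_diff)
lift_definition uminus_ell2 :: "'a ell2 \<Rightarrow> 'a ell2" is "\<lambda>f n. - f n"
  by (rule square_summable_uminus)
lift_definition scaleR_ell2 :: "real \<Rightarrow> 'a ell2 \<Rightarrow> 'a ell2" is "\<lambda>r f n. r *\<^sub>R f n"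
  by (rule square_summable_scaleR)
lift_definition norm_ell2 :: "'a ell2 \<Rightarrow> real" is "\<lambda>f. sqrt (\<Sum>n. (norm (f n))\<^sup>2)" .

definition dist_ell2 :: "'a ell2 \<Rightarrow> 'a ell2 \<Rightarrow> real" where
  "dist_ell2 x y = norm (x - y)"
definition sgn_ell2 :: "'a ell2 \<Rightarrow> 'a ell2" where
  "sgn_ell2 x = inverse (norm x) *\<^sub>R x"
definition uniformity_ell2 :: "('a ell2 \<times> 'a ell2) filter" where
  "uniformity_ell2 = (INF e\<in>{0<..}. principal {(x, y). dist x y < e})"
definition open_ell2 :: "'a ell2 set \<Rightarrow> bool" where
  "open_ell2 U = (\<forall>x\<in>U. \<forall>\<^sub>F (x', y) in uniformity. x' = x \<longrightarrow> y \<in> U)"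

instance
proof
  fix x y z :: "'a ell2" and r s :: real and U :: "'a ell2 set"
  show "x + y + z = x + (y + z)" by transfer (simp add: add.assoc)
  show "x + y = y + x" by transfer (simp add: add.commute)
  show "0 + x = x" by transfer simp
  show "- x + x = 0" by transfer simp
  show "x - y = x + - y" by transfer simp
  show "r *\<^sub>R (x + y) = r *\<^sub>R x + r *\<^sub>R y" by transfer (simp add: scaleR_add_right)
  show "(r + s) *\<^sub>R x = r *\<^sub>R x + s *\<^sub>R x" by transfer (simp add: scaleR_add_left)
  show "r *\<^sub>R s *\<^sub>R x = (r * s) *\<^sub>R x" by transfer simp
  show "1 *\<^sub>R x = x" by transfer simp
  show "dist x y = norm (x - y)" by (rule dist_ell2_def)
  show "sgn x = inverse (norm x) *\<^sub>R x" by (rule sgn_ell2_def)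
  show "uniformity = (INF e\<in>{0<..}. principal {(x :: 'a ell2, y). dist x y < e})"
    by (rule uniformity_ell2_def)
  show "open U = (\<forall>x\<in>U. \<forall>\<^sub>F (x', y) in uniformity. x' = x \<longrightarrow> y \<in> U)"
    by (rule open_ell2_def)
  show "norm x = 0 \<longleftrightarrow> x = 0"
    by transfer (auto simp: square_summable_def suminf_eq_zero_iff)
  show "norm (x + y) \<le> norm x + norm y"
    by transfer (rule square_summable_norm_add)
  show "norm (r *\<^sub>R x) = \<bar>r\<bar> * norm x"
    by transfer (simp add: square_summable_def power_mult_distrib suminf_mult real_sqrt_mult)
qed

end

lemma ell2_L2_set_le: "L2_set (\<lambda>n. norm (coord x n)) {..<k} \<le> norm x"
  by transfer (simp add: square_summable_L2_set_le)

lemma norm_coord_le: "norm (coord x n) \<le> norm x"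
proof -
  have "norm (coord x n) \<le> L2_set (\<lambda>n. norm (coord x n)) {..<Suc n}"
    by (rule member_le_L2_set) auto
  also have "\<dots> \<le> norm x"
    by (rule ell2_L2_set_le)
  finally show ?thesis .
qed

instance ell2 :: (banach) banach
proof
  fix X :: "nat \<Rightarrow> 'a ell2"
  assume X: "Cauchy X"
  have "Cauchy (\<lambda>m. coord (X m) n)" for n
  proof (rule CauchyI)
    fix e :: real assume "0 < e"
    then obtain N where "\<And>m k. m \<ge> N \<Longrightarrow> k \<ge> N \<Longrightarrow> norm (X m - X k) < e"
      using X CauchyD by blast
    moreover have "norm (coord (X m) n - coord (X k) n) \<le> norm (X m - X k)" for m k
      using norm_coord_le[of "X m - X k" n] by (simp add: minus_ell2.rep_eq)
    ultimately show "\<exists>N. \<forall>m\<ge>N. \<forall>k\<ge>N. norm (coord (X m) n - coord (X k) n) < e"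
      by (meson le_less_trans)
  qed
  then have "\<exists>l. (\<lambda>m. coord (X m) n) \<longlonglongrightarrow> l" for n
    using Cauchy_convergent convergent_def by blast
  then obtain y where y: "\<And>n. (\<lambda>m. coord (X m) n) \<longlonglongrightarrow> y n"
    by metis
  have le: "L2_set (\<lambda>n. norm (coord (X m) n - y n)) {..<k} \<le> e"
    if N: "\<And>m k. m \<ge> N \<Longrightarrow> k \<ge> N \<Longrightarrow> norm (X m - X k) < e" and m: "m \<ge> N" for N m k e
  proof (rule tendsto_upperbound)
    show "(\<lambda>j. L2_set (\<lambda>n. norm (coord (X m) n - coord (X j) n)) {..<k})
        \<longlonglongrightarrow> L2_set (\<lambda>n. norm (coord (X m) n - y n)) {..<k}"
      unfolding L2_set_def by (intro tendsto_intros y)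
    have "L2_set (\<lambda>n. norm (coord (X m) n - coord (X j) n)) {..<k} \<le> e" if "j \<ge> N" for j
      using ell2_L2_set_le[of "X m - X j" k] N[OF m that] by (simp add: minus_ell2.rep_eq)
    then show "\<forall>\<^sub>F j in sequentially.
        L2_set (\<lambda>n. norm (coord (X m) n - coord (X j) n)) {..<k} \<le> e"
      by (auto simp: eventually_sequentially)
  qed simp
  obtain N1 where N1: "\<And>m k. m \<ge> N1 \<Longrightarrow> k \<ge> N1 \<Longrightarrow> norm (X m - X k) < 1"
    using X CauchyD[of X 1] by auto
  have "square_summable (\<lambda>n. coord (X N1) n - y n)"
    by (rule square_summable_bounded(1)[where c=1]) (rule le[OF N1], auto)
  from square_summable_diff[OF square_summable_coord[of "X N1"] this]
  have sy: "square_summable y"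
    by simp
  have "X \<longlonglongrightarrow> Abs_ell2 y"
  proof (rule LIMSEQ_I)
    fix e :: real assume "0 < e"
    then obtain N where N: "\<And>m k. m \<ge> N \<Longrightarrow> k \<ge> N \<Longrightarrow> norm (X m - X k) < e / 2"
      using X CauchyD[of X "e / 2"] by auto
    have "norm (X m - Abs_ell2 y) < e" if "m \<ge> N" for m
    proof -
      have "norm (X m - Abs_ell2 y) = sqrt (\<Sum>n. (norm (coord (X m) n - y n))\<^sup>2)"
        using sy by (simp add: norm_ell2.rep_eq minus_ell2.rep_eq Abs_ell2_inverse)
      also have "\<dots> \<le> e / 2"
        by (rule square_summable_bounded(2)) (rule le[OF N that])
      finally show ?thesis using \<open>0 < e\<close> by simp
    qed
    then show "\<exists>N. \<forall>m\<ge>N. norm (X m - Abs_ell2 y) < e"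
      by blast
  qed
  then show "convergent X"
    by (rule convergentI)
qed

text \<open>Indices start at 0 instead of 1. The decomposition of a sequence into its first and its
  remaining coordinates is \<open>x = ell2_cons (coord x 0) (ell2_tl x)\<close>.\<close>

lemma square_summable_case_nat:
  assumes "square_summable f"
  shows "square_summable (case_nat c f)"
  using assms summable_Suc_iff[of "\<lambda>n. (norm (case_nat c f n))\<^sup>2"]
  by (simp add: square_summable_def)

lift_definition ell2_cons :: "'a::real_normed_vector \<Rightarrow> 'a ell2 \<Rightarrow> 'a ell2" is case_nat
  by (rule square_summable_case_nat)

lift_definition ell2_tl :: "'a::real_normed_vector ell2 \<Rightarrow> 'a ell2" is "\<lambda>f n. f (Suc n)"
  unfolding square_summable_def by (subst summable_Suc_iff)

lemma coord_ell2_cons [simp]: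
  "coord (ell2_cons c x) 0 = c" "coord (ell2_cons c x) (Suc n) = coord x n"
  by (transfer, simp)+

lemma coord_ell2_tl [simp]: "coord (ell2_tl x) n = coord x (Suc n)"
  by transfer simp

lemma ell2_cons_coord_tl: "ell2_cons (coord x 0) (ell2_tl x) = x"
  by (rule ell2_eqI) (case_tac n; simp)

lemma ell2_cons_add: "ell2_cons (c + d) (x + y) = ell2_cons c x + ell2_cons d y"
  by (rule ell2_eqI) (case_tac n; simp add: plus_ell2.rep_eq)

lemma ell2_cons_scaleR: "ell2_cons (r *\<^sub>R c) (r *\<^sub>R x) = r *\<^sub>R ell2_cons c x"
  by (rule ell2_eqI) (case_tac n; simp add: scaleR_ell2.rep_eq)

lemma ell2_tl_add: "ell2_tl (x + y) = ell2_tl x + ell2_tl y"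
  by (rule ell2_eqI) (simp add: plus_ell2.rep_eq)

lemma ell2_tl_scaleR: "ell2_tl (r *\<^sub>R x) = r *\<^sub>R ell2_tl x"
  by (rule ell2_eqI) (simp add: scaleR_ell2.rep_eq)

lemma norm_ell2_cons: "norm (ell2_cons c x) = sqrt ((norm c)\<^sup>2 + (norm x)\<^sup>2)"
proof -
  have "(\<Sum>n. (norm (coord (ell2_cons c x) n))\<^sup>2) = (norm c)\<^sup>2 + (\<Sum>n. (norm (coord x n))\<^sup>2)"
    using suminf_split_head[of "\<lambda>n. (norm (coord (ell2_cons c x) n))\<^sup>2"]
      square_summable_coord[of "ell2_cons c x"]
    by (simp add: square_summable_def)
  moreover have "(\<Sum>n. (norm (coord x n))\<^sup>2) \<ge> 0"
    using square_summable_coord[of x] by (intro suminf_nonneg) (auto simp: square_summable_def)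
  ultimately show ?thesis
    by (simp add: norm_ell2.rep_eq)
qed

lemma norm_ell2_tl_le: "norm (ell2_tl x) \<le> norm x"
  using norm_ell2_cons[of "coord x 0" "ell2_tl x"]
  by (simp add: ell2_cons_coord_tl real_le_rsqrt)

lift_definition right_shift :: "'a::real_normed_vector ell2 \<Rightarrow>\<^sub>L 'a ell2" is "ell2_cons 0"
proof (rule bounded_linear_intro[where K=1])
  show "ell2_cons 0 (x + y) = ell2_cons 0 x + ell2_cons 0 y" for x y :: "'a ell2"
    using ell2_cons_add[of 0 0 x y] by simp
  show "ell2_cons 0 (r *\<^sub>R x) = r *\<^sub>R ell2_cons 0 x" for r and x :: "'a ell2"
    using ell2_cons_scaleR[of r 0 x] by simp
qed (simp add: norm_ell2_cons)

text \<open>The block-diagonal operator with blocks \<open>r\<close> (on the first coordinate) and \<open>T\<close> (on the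
  remaining coordinates).\<close>

lift_definition block_diag ::
    "real \<Rightarrow> ('a::real_normed_vector ell2 \<Rightarrow>\<^sub>L 'a ell2) \<Rightarrow> ('a ell2 \<Rightarrow>\<^sub>L 'a ell2)"
  is "\<lambda>r T x. ell2_cons (r *\<^sub>R coord x 0) (T (ell2_tl x))"
proof -
  fix r and T :: "'a ell2 \<Rightarrow> 'a ell2"
  assume T: "bounded_linear T"
  then interpret T: bounded_linear T .
  obtain K where K: "K \<ge> 0" "\<And>x. norm (T x) \<le> norm x * K"
    using T.nonneg_bounded by blast
  show "bounded_linear (\<lambda>x. ell2_cons (r *\<^sub>R coord x 0) (T (ell2_tl x)))"
  proof (rule bounded_linear_intro[where K="\<bar>r\<bar> + K"])
    fix x y :: "'a ell2" and s :: real
    show "ell2_cons (r *\<^sub>R coord (x + y) 0) (T (ell2_tl (x + y))) =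
        ell2_cons (r *\<^sub>R coord x 0) (T (ell2_tl x)) + ell2_cons (r *\<^sub>R coord y 0) (T (ell2_tl y))"
      by (simp add: plus_ell2.rep_eq ell2_tl_add T.add scaleR_add_right flip: ell2_cons_add)
    show "ell2_cons (r *\<^sub>R coord (s *\<^sub>R x) 0) (T (ell2_tl (s *\<^sub>R x))) =
        s *\<^sub>R ell2_cons (r *\<^sub>R coord x 0) (T (ell2_tl x))"
      by (simp add: scaleR_ell2.rep_eq ell2_tl_scaleR T.scaleR mult.commute flip: ell2_cons_scaleR)
    have "norm (ell2_cons (r *\<^sub>R coord x 0) (T (ell2_tl x)))
        \<le> norm (r *\<^sub>R coord x 0) + norm (T (ell2_tl x))"
      by (simp add: norm_ell2_cons sqrt_sum_squares_le_sum del: norm_scaleR)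
    also have "\<dots> \<le> \<bar>r\<bar> * norm x + norm x * K"
    proof (rule add_mono)
      show "norm (r *\<^sub>R coord x 0) \<le> \<bar>r\<bar> * norm x"
        by (simp add: mult_left_mono norm_coord_le)
      have "norm (T (ell2_tl x)) \<le> norm (ell2_tl x) * K"
        by (rule K(2))
      also have "\<dots> \<le> norm x * K"
        by (intro mult_right_mono norm_ell2_tl_le K(1))
      finally show "norm (T (ell2_tl x)) \<le> norm x * K" .
    qed
    finally show "norm (ell2_cons (r *\<^sub>R coord x 0) (T (ell2_tl x))) \<le> norm x * (\<bar>r\<bar> + K)"
      by (simp add: algebra_simps)
  qed
qed

definition L_op :: "real \<Rightarrow> real \<Rightarrow> 'a::real_normed_vector ell2 \<Rightarrow>\<^sub>L 'a ell2" where
  "L_op a \<nu> = block_diag a (\<nu> *\<^sub>R right_shift + a *\<^sub>R id_blinfun)"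

definition D_op :: "real \<Rightarrow> real \<Rightarrow> 'a::real_normed_vector ell2 \<Rightarrow>\<^sub>L 'a ell2" where
  "D_op a \<nu> = (- \<nu> / a) *\<^sub>R block_diag 0 right_shift"

lemma L_op_eq: "a \<noteq> 0 \<Longrightarrow> L_op a \<nu> = a *\<^sub>R (id_blinfun - D_op a \<nu>)"
proof (rule blinfun_eqI, rule ell2_eqI)
  fix x :: "'a ell2" and n
  assume "a \<noteq> 0"
  then show "coord (blinfun_apply (L_op a \<nu>) x) n
      = coord (blinfun_apply (a *\<^sub>R (id_blinfun - D_op a \<nu>)) x) n"
    by (cases n) (simp_all add: L_op_def D_op_def block_diag.rep_eq right_shift.rep_eq
        blinfun.bilinear_simps plus_ell2.rep_eq minus_ell2.rep_eq scaleR_ell2.rep_eq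
        uminus_ell2.rep_eq algebra_simps)
qed

definition blinfun_power ::
    "('a::real_normed_vector \<Rightarrow>\<^sub>L 'a) \<Rightarrow> nat \<Rightarrow> ('a \<Rightarrow>\<^sub>L 'a)" where
  "blinfun_power T n = (((o\<^sub>L) T) ^^ n) id_blinfun"

definition log_id_minus :: "('a::real_normed_vector \<Rightarrow>\<^sub>L 'a) \<Rightarrow> ('a \<Rightarrow>\<^sub>L 'a)" where
  "log_id_minus T = - (\<Sum>n. (1 / real (Suc n)) *\<^sub>R blinfun_power T (Suc n))"

definition A_op :: "real \<Rightarrow> real \<Rightarrow> 'a::real_normed_vector ell2 \<Rightarrow>\<^sub>L 'a ell2" where
  "A_op a \<nu> = ln a *\<^sub>R id_blinfun + log_id_minus (D_op a \<nu>)"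

definition bounded_ucont_precompact :: "(real \<Rightarrow> 'b::real_normed_vector) set" where
  "bounded_ucont_precompact =
     {B. bounded (range B) \<and> uniformly_continuous_on UNIV B \<and> compact (closure (range B))}"

definition has_mean_value :: "(real \<Rightarrow> 'b::real_normed_vector) \<Rightarrow> 'b \<Rightarrow> bool" where
  "has_mean_value B m \<longleftrightarrow> (\<forall>\<epsilon>>0. \<exists>T0>0. \<forall>T\<ge>T0. \<forall>s.
     norm ((1 / T) *\<^sub>R integral {s..s+T} B - m) < \<epsilon>)"

definition generalized_almost_periodic :: "(real \<Rightarrow> 'b::real_normed_vector) \<Rightarrow> bool" where
  "generalized_almost_periodic B \<longleftrightarrow> B \<in> bounded_ucont_precompact \<and> (\<exists>m. has_mean_value B m)"

definition operator_solution ::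
    "(real \<Rightarrow> 'a::real_normed_vector \<Rightarrow>\<^sub>L 'a) \<Rightarrow> (real \<Rightarrow> 'a \<Rightarrow>\<^sub>L 'a) \<Rightarrow> bool" where
  "operator_solution C Y \<longleftrightarrow> Y 0 = id_blinfun \<and>
     (\<forall>t. (Y has_vector_derivative (C t o\<^sub>L Y t)) (at t))"

text \<open>Only meaningful for operators with a bounded two-sided inverse, such as the values of an
  operator solution for continuous coefficients.\<close>

definition blinfun_inv :: "('a::real_normed_vector \<Rightarrow>\<^sub>L 'a) \<Rightarrow> ('a \<Rightarrow>\<^sub>L 'a)" where
  "blinfun_inv T = (THE S. S o\<^sub>L T = id_blinfun \<and> T o\<^sub>L S = id_blinfun)"

definition evolution_operator ::
    "(real \<Rightarrow> 'a::real_normed_vector \<Rightarrow>\<^sub>L 'a) \<Rightarrow> real \<Rightarrow> real \<Rightarrow> ('a \<Rightarrow>\<^sub>L 'a)" where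
  "evolution_operator Y t s = Y t o\<^sub>L blinfun_inv (Y s)"

end

theory Submission
  imports Defs
begin

text \<open>
  The exponential of \<open>A\<close> is \<open>L\<close>, and \<open>\<parallel>L\<parallel> \<le> a + \<nu> < 1\<close>; hence \<open>exp (n A) = L ^ n\<close> has norm at most
  \<open>1/4\<close> for some \<open>n = \<tau>\<close>. Since \<open>B\<close> has mean value zero, the antiderivative of \<open>r \<mapsto> B (\<omega> r)\<close> that
  vanishes at \<open>s\<close> is uniformly small on \<open>[s, s + \<tau>]\<close> when \<open>\<omega>\<close> is large. Over a time step \<open>\<tau>\<close> the
  solutions of (ii) are therefore so close to those of (i) that their norm is at least halved, and
  between the steps it grows at most by a fixed factor. The proof works in an arbitrary Banach
  algebra.
\<close>

subsection \<open>Exponential and logarithm in Banach algebras\<close>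

text \<open>The series tail is dominated term by term by the tail for the real number
  \<open>norm h\<close>, to which the bound \<open>exp x \<le> 1 + x + x^2\<close> on the unit
  interval applies.\<close>

lemma norm_exp_minus_first_two_le:
  fixes h :: "'a::{real_normed_algebra_1, banach}"
  assumes "norm h \<le> 1"
  shows "norm (exp h - 1 - h) \<le> (norm h)\<^sup>2"
proof -
  have sm: "summable (\<lambda>n. inverse (fact (n + 2)) *\<^sub>R (norm h ^ (n + 2)))"
    using summable_ignore_initial_segment[OF summable_exp_generic[of "norm h"], of 2]
    by (simp add: field_simps)
  have "norm (exp h - 1 - h) = norm (\<Sum>n. inverse (fact (n + 2)) *\<^sub>R (h ^ (n + 2)))"
    by (simp add: exp_first_two_terms[of h])
  also have "\<dots> \<le> (\<Sum>n. inverse (fact (n + 2)) *\<^sub>R (norm h ^ (n + 2)))"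
  proof (rule norm_suminf_le[OF _ sm])
    show "norm (inverse (fact (n + 2)) *\<^sub>R h ^ (n + 2)) \<le> inverse (fact (n + 2)) *\<^sub>R norm h ^ (n + 2)"
      for n
      using norm_power_ineq[of h "n + 2"] by (simp add: mult_left_mono del: power_Suc)
  qed
  also have "\<dots> = exp (norm h) - 1 - norm h"
    by (simp add: exp_first_two_terms[of "norm h"])
  also have "\<dots> \<le> (norm h)\<^sup>2"
    using exp_bound[of "norm h"] assms by simp
  finally show ?thesis .
qed

text \<open>The quadratic remainder bound, divided by \<open>norm h\<close>, tends to 0.\<close>

lemma has_derivative_exp_0:
  "(exp has_derivative (\<lambda>h. h)) (at (0 :: 'a::{real_normed_algebra_1, banach}))"
proof (rule has_derivativeI_sandwich[of 1 _ _ _ _ norm])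
  fix h :: 'a
  assume "h \<noteq> 0" "dist h 0 < 1"
  then show "norm (exp h - exp 0 - (h - 0)) / norm (h - 0) \<le> norm h"
    using norm_exp_minus_first_two_le[of h] by (simp add: field_simps power2_eq_square)
qed (auto intro: tendsto_norm_zero)

text \<open>For commuting values, \<open>exp (f t) = exp (f s) * exp (f t - f s)\<close> reduces the derivative at
  \<open>s\<close> to that of \<open>exp\<close> at \<open>0\<close>.\<close>

lemma has_vector_derivative_exp_commuting:
  fixes f :: "real \<Rightarrow> 'a::{real_normed_algebra_1, banach}"
  assumes f: "(f has_vector_derivative f') (at s within S)" and "s \<in> S"
    and comm: "\<And>t. t \<in> S \<Longrightarrow> f s * f t = f t * f s"
  shows "((\<lambda>t. exp (f t)) has_vector_derivative exp (f s) * f') (at s within S)"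
proof -
  have "((\<lambda>t. f t - f s) has_vector_derivative f') (at s within S)"
    using f by (auto intro!: derivative_eq_intros)
  then have "((\<lambda>t. exp (f t - f s)) has_derivative (\<lambda>h. h *\<^sub>R f')) (at s within S)"
    using has_derivative_compose[of "\<lambda>t. f t - f s" "\<lambda>h. h *\<^sub>R f'" s S exp "\<lambda>h. h"]
      has_derivative_exp_0
    by (simp add: has_vector_derivative_def)
  then have "((\<lambda>t. exp (f s) * exp (f t - f s)) has_vector_derivative exp (f s) * f')
      (at s within S)"
    by (auto simp: has_vector_derivative_def intro!: derivative_eq_intros)
  moreover have "exp (f s) * exp (f t - f s) = exp (f t)" if "t \<in> S" for t
    using comm[OF that] by (subst exp_add_commuting[symmetric]) (auto simp: algebra_simps)
  ultimately show ?thesis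
    using has_vector_derivative_transform[OF \<open>s \<in> S\<close>, where g = "\<lambda>t. exp (f t)"
        and f = "\<lambda>t. exp (f s) * exp (f t - f s)"] by simp
qed

lemma exp_scaleR_of_nat:
  fixes x :: "'a::{real_normed_algebra_1, banach}"
  shows "exp (real n *\<^sub>R x) = exp x ^ n"
proof (induction n)
  case (Suc n)
  have "exp (real (Suc n) *\<^sub>R x) = exp (x + real n *\<^sub>R x)"
    by (simp add: algebra_simps)
  also have "\<dots> = exp x * exp (real n *\<^sub>R x)"
    by (rule exp_add_commuting) simp
  finally show ?case
    by (simp add: Suc.IH)
qed simp

text \<open>The power series of log (1 - x), shifted so that the index starts at 0; the algebra
  counterpart of \<open>log_id_minus\<close>.\<close>

definition log_one_minus :: "'a::{real_normed_algebra_1, banach} \<Rightarrow> 'a" where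
  "log_one_minus x = - (\<Sum>n. (1 / real (Suc n)) *\<^sub>R x ^ Suc n)"

lemma summable_norm_power_Suc:
  fixes x :: "'a::real_normed_algebra_1"
  assumes "norm x < 1"
  shows "summable (\<lambda>n. norm x ^ Suc n)"
  using assms summable_geometric[of "norm x"] by (simp add: summable_mult)

text \<open>A majorant, uniform in \<open>s\<close>, for the termwise differentiated logarithm
  series; it feeds the Weierstrass test.\<close>

lemma norm_scaleR_power_Suc_le:
  fixes x :: "'a::real_normed_algebra_1"
  assumes "s \<in> {0..1}"
  shows "norm (s ^ n *\<^sub>R x ^ Suc n) \<le> norm x ^ Suc n"
proof -
  have "norm (s ^ n *\<^sub>R x ^ Suc n) \<le> 1 * norm (x ^ Suc n)"
    unfolding norm_scaleR using assms by (intro mult_right_mono) (auto simp: power_le_one)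
  then show ?thesis
    using norm_power_ineq[of x "Suc n"] by linarith
qed

lemma summable_log_one_minus:
  fixes x :: "'a::{real_normed_algebra_1, banach}"
  assumes "norm x < 1"
  shows "summable (\<lambda>n. (1 / real (Suc n)) *\<^sub>R x ^ Suc n)"
proof (rule summable_comparison_test[OF exI[of _ 0] summable_norm_power_Suc[OF assms]],
    intro allI impI)
  fix n
  have "norm ((1 / real (Suc n)) *\<^sub>R x ^ Suc n) \<le> 1 * norm (x ^ Suc n)"
    unfolding norm_scaleR by (intro mult_right_mono) auto
  then show "norm ((1 / real (Suc n)) *\<^sub>R x ^ Suc n) \<le> norm x ^ Suc n"
    using norm_power_ineq[of x "Suc n"] by linarith
qed

text \<open>\<open>y\<close> commutes with every power of \<open>x\<close>, hence with the sum of
  the series. This makes the logarithms along a segment commute, so that their exponential can be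
  differentiated.\<close>

lemma log_one_minus_commute:
  fixes x y :: "'a::{real_normed_algebra_1, banach}"
  assumes "norm x < 1" "x * y = y * x"
  shows "log_one_minus x * y = y * log_one_minus x"
proof -
  have "x ^ n * y = y * x ^ n" for n
    by (induction n) (auto simp: assms(2) algebra_simps, metis assms(2) mult.assoc)
  then show ?thesis
    using summable_log_one_minus[OF assms(1)]
    by (simp add: log_one_minus_def suminf_mult[symmetric] suminf_mult2 del: power_Suc)
qed

text \<open>Termwise differentiation along the segment from 0 to \<open>x\<close>: the factor
  \<open>1 / real (Suc n)\<close> cancels, and the differentiated series converges uniformly in
  \<open>s\<close>.\<close>

lemma has_vector_derivative_log_one_minus:
  fixes x :: "'a::{real_normed_algebra_1, banach}"
  assumes "norm x < 1" and s: "s \<in> {0..1}"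
  shows "((\<lambda>s. log_one_minus (s *\<^sub>R x)) has_vector_derivative - (\<Sum>n. s ^ n *\<^sub>R x ^ Suc n))
    (at s within {0..1})"
proof -
  let ?f = "\<lambda>n s. (1 / real (Suc n)) *\<^sub>R (s *\<^sub>R x) ^ Suc n"
  let ?g = "\<lambda>s. \<Sum>n. s ^ n *\<^sub>R x ^ Suc n"
  have le: "norm (s *\<^sub>R x) < 1" if "s \<in> {0..1}" for s :: real
    using that assms(1) mult_right_mono[of s 1 "norm x"] by simp
  have unif: "uniform_limit {0..1} (\<lambda>n s. \<Sum>i<n. s ^ i *\<^sub>R x ^ Suc i) ?g sequentially"
    by (rule Weierstrass_m_test[OF norm_scaleR_power_Suc_le summable_norm_power_Suc[OF assms(1)]])
  have "\<exists>g. \<forall>s\<in>{0..1}. (\<lambda>n. ?f n s) sums g s \<and>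
      (g has_derivative (\<lambda>h. h *\<^sub>R ?g s)) (at s within {0..1})"
  proof (rule has_derivative_series[where f' = "\<lambda>n s h. h *\<^sub>R s ^ n *\<^sub>R x ^ Suc n"])
    show "((\<lambda>s. ?f n s) has_derivative (\<lambda>h. h *\<^sub>R s ^ n *\<^sub>R x ^ Suc n))
        (at s within {0..1})" for n s
    proof -
      have "((\<lambda>s. (1 / real (Suc n)) * s ^ Suc n) has_derivative (\<lambda>h. h * s ^ n))
          (at s within {0..1})"
        by (auto intro!: derivative_eq_intros simp del: power_Suc)
      from has_derivative_scaleR_left[OF this, of "x ^ Suc n"] show ?thesis
        by (simp add: scaleR_power del: power_Suc of_nat_Suc)
    qed
    fix e :: real
    assume "e > 0"
    from uniform_limitD[OF unif this]
    show "\<forall>\<^sub>F n in sequentially. \<forall>s\<in>{0..1}. \<forall>h.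
        norm ((\<Sum>i<n. h *\<^sub>R s ^ i *\<^sub>R x ^ Suc i) - h *\<^sub>R ?g s) \<le> e * norm h"
    proof eventually_elim
      case (elim n)
      show ?case
      proof (intro ballI allI)
        fix s h :: real
        assume "s \<in> {0..1}"
        then have "norm ((\<Sum>i<n. s ^ i *\<^sub>R x ^ Suc i) - ?g s) \<le> e"
          using elim by (auto simp: dist_norm intro: less_imp_le)
        then have "\<bar>h\<bar> * norm ((\<Sum>i<n. s ^ i *\<^sub>R x ^ Suc i) - ?g s) \<le> \<bar>h\<bar> * e"
          by (intro mult_left_mono) auto
        then show "norm ((\<Sum>i<n. h *\<^sub>R s ^ i *\<^sub>R x ^ Suc i) - h *\<^sub>R ?g s) \<le> e * norm h"
          by (simp only: scaleR_sum_right[symmetric] scaleR_diff_right[symmetric] norm_scaleR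
              real_norm_def mult.commute[of e])
      qed
    qed
  next
    show "(\<lambda>n. ?f n s) sums suminf (\<lambda>n. ?f n s)"
      using summable_log_one_minus[OF le[OF s]] by (rule summable_sums)
  qed (use s in auto)
  then obtain g where "\<forall>s\<in>{0..1}. (\<lambda>n. ?f n s) sums g s \<and>
      (g has_derivative (\<lambda>h. h *\<^sub>R ?g s)) (at s within {0..1})" ..
  then have g: "\<And>s. s \<in> {0..1} \<Longrightarrow> (\<lambda>n. ?f n s) sums g s"
    "(g has_vector_derivative ?g s) (at s within {0..1})"
    unfolding has_vector_derivative_def using s by (blast, blast)
  have "((\<lambda>s. - g s) has_vector_derivative - ?g s) (at s within {0..1})"
    using g(2) by (auto intro!: derivative_eq_intros)
  moreover have "log_one_minus (s *\<^sub>R x) = - g s" if "s \<in> {0..1}" for s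
    using sums_unique[OF g(1)[OF that]] by (simp add: log_one_minus_def)
  ultimately show ?thesis
    by (intro has_vector_derivative_transform[OF s, of "\<lambda>s. log_one_minus (s *\<^sub>R x)"]) auto
qed

text \<open>The product \<open>exp (- log_one_minus (s *\<^sub>R x)) * (1 - s *\<^sub>R x)\<close> has derivative \<open>0\<close> in \<open>s\<close>.\<close>

theorem exp_log_one_minus:
  fixes x :: "'a::{real_normed_algebra_1, banach}"
  assumes "norm x < 1"
  shows "exp (log_one_minus x) = 1 - x"
proof -
  let ?l = "\<lambda>s. log_one_minus (s *\<^sub>R x)" and ?g = "\<lambda>s. \<Sum>n. s ^ n *\<^sub>R x ^ Suc n"
  let ?K = "\<lambda>s. exp (- ?l s) * (1 - s *\<^sub>R x)"
  have le: "norm (s *\<^sub>R x) < 1" if "s \<in> {0..1}" for s :: real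
    using that assms(1) mult_right_mono[of s 1 "norm x"] by simp
  \<comment> \<open>The geometric series: removing its first term \<open>x\<close> amounts to
    multiplying the sum by \<open>s *\<^sub>R x\<close>.\<close>
  have g: "?g s * (1 - s *\<^sub>R x) = x" if s: "s \<in> {0..1}" for s
  proof -
    have sm: "summable (\<lambda>n. s ^ n *\<^sub>R x ^ Suc n)"
      by (rule summable_comparison_test[OF exI[of _ 0] summable_norm_power_Suc[OF assms]])
        (use norm_scaleR_power_Suc_le[OF s] in blast)
    have "(\<lambda>n. s ^ Suc n *\<^sub>R x ^ Suc (Suc n)) sums (?g s - x)"
      using sums_Suc_iff[of "\<lambda>n. s ^ n *\<^sub>R x ^ Suc n" "?g s - x"] summable_sums[OF sm] by simp
    moreover have "(\<lambda>n. s ^ Suc n *\<^sub>R x ^ Suc (Suc n)) sums (?g s * s *\<^sub>R x)"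
      using sums_mult2[OF summable_sums[OF sm], of "s *\<^sub>R x"]
      by (simp add: power_commutes mult.assoc mult.commute)
    ultimately have "?g s - x = ?g s * s *\<^sub>R x"
      by (rule sums_unique2)
    then show ?thesis
      by (simp add: algebra_simps)
  qed
  have "(?K has_vector_derivative 0) (at s within {0..1})" if s: "s \<in> {0..1}" for s
  proof -
    have comm: "?l s * ?l t = ?l t * ?l s" if "t \<in> {0..1}" for t
      using le that s by (intro log_one_minus_commute log_one_minus_commute[symmetric]) auto
    have "((\<lambda>s. - ?l s) has_vector_derivative ?g s) (at s within {0..1})"
      using has_vector_derivative_minus[OF has_vector_derivative_log_one_minus[OF assms s]] by simp
    then have "((\<lambda>s. exp (- ?l s)) has_vector_derivative exp (- ?l s) * ?g s) (at s within {0..1})"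
      by (rule has_vector_derivative_exp_commuting) (use s comm in auto)
    moreover have "((\<lambda>s. 1 - s *\<^sub>R x) has_vector_derivative - x) (at s within {0..1})"
      by (auto intro!: derivative_eq_intros)
    ultimately have "(?K has_vector_derivative
        exp (- ?l s) * (- x) + exp (- ?l s) * ?g s * (1 - s *\<^sub>R x)) (at s within {0..1})"
      by (rule has_vector_derivative_mult)
    then show ?thesis
      by (simp add: mult.assoc g[OF s] del: power_Suc)
  qed
  then obtain c where c: "\<And>s. s \<in> {0..1} \<Longrightarrow> ?K s = c"
    using has_vector_derivative_zero_constant[of "{0..1}" ?K] by auto
  \<comment> \<open>At \<open>s = 0\<close> every term of the logarithm series vanishes, so the
    constant is \<open>exp 0 = 1\<close>.\<close>
  have "?K 1 = 1"
    using c[of 0] c[of 1] by (simp add: log_one_minus_def)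
  then have "exp (- log_one_minus x) * (1 - x) = 1"
    by simp
  \<comment> \<open>Multiplication by \<open>exp (log_one_minus x)\<close> from the left isolates
    \<open>1 - x\<close>.\<close>
  then show ?thesis
    using exp_minus_inverse[of "log_one_minus x"]
    by (metis mult.assoc mult.left_neutral mult.right_neutral)
qed

subsection \<open>Averaging for linear equations in Banach algebras\<close>

text \<open>A substitute for Gronwall's inequality, valid in both time directions. By the mean value
  inequality \<open>Z\<close> varies by at most a quarter of the maximum of its norm; that maximum
  is thus at most 4/3 of \<open>norm (Z q)\<close>, and the variation at most 1/3 of it.\<close>

lemma norm_diff_le_half_of_linear_growth:
  fixes Z :: "real \<Rightarrow> 'a::real_normed_vector"
  assumes deriv: "\<And>r. r \<in> {u..v} \<Longrightarrow> (Z has_vector_derivative Z' r) (at r within {u..v})"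
    and bound: "\<And>r. r \<in> {u..v} \<Longrightarrow> norm (Z' r) \<le> c * norm (Z r)"
    and "c \<ge> 0" and c: "c * (v - u) \<le> 1 / 4"
    and p: "p \<in> {u..v}" and q: "q \<in> {u..v}"
  shows "norm (Z p - Z q) \<le> norm (Z q) / 2"
proof -
  have "continuous_on {u..v} Z"
    unfolding continuous_on_eq_continuous_within using deriv has_vector_derivative_continuous by blast
  then have "continuous_on {u..v} (\<lambda>r. norm (Z r))"
    by (rule continuous_on_norm)
  then obtain m where m: "m \<in> {u..v}" "\<And>r. r \<in> {u..v} \<Longrightarrow> norm (Z r) \<le> norm (Z m)"
    using continuous_attains_sup[of "{u..v}" "\<lambda>r. norm (Z r)"] p by auto
  have diff: "norm (Z x - Z y) \<le> norm (Z m) / 4" if x: "x \<in> {u..v}" and y: "y \<in> {u..v}" for x y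
  proof -
    have "norm (Z x - Z y) \<le> (c * norm (Z m)) * norm (x - y)"
    proof (rule differentiable_bound[of "{u..v}" Z "\<lambda>r h. h *\<^sub>R Z' r"])
      show "onorm (\<lambda>h. h *\<^sub>R Z' r) \<le> c * norm (Z m)" if r: "r \<in> {u..v}" for r
      proof (rule onorm_le)
        fix h :: real
        have "norm (Z' r) \<le> c * norm (Z m)"
          using bound[OF r] mult_left_mono[OF m(2)[OF r] \<open>c \<ge> 0\<close>] by linarith
        then show "norm (h *\<^sub>R Z' r) \<le> c * norm (Z m) * norm h"
          using mult_left_mono[of "norm (Z' r)" "c * norm (Z m)" "\<bar>h\<bar>"]
          by (simp add: mult.commute)
      qed
    qed (use deriv x y in \<open>auto simp: has_vector_derivative_def\<close>)
    also have "\<dots> \<le> (c * norm (Z m)) * (v - u)"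
      using x y \<open>c \<ge> 0\<close> by (intro mult_left_mono) auto
    also have "\<dots> \<le> norm (Z m) / 4"
      using mult_right_mono[OF c, of "norm (Z m)"] by (simp add: mult_ac)
    finally show ?thesis .
  qed
  have "norm (Z m) \<le> norm (Z q) + norm (Z m) / 4"
    using diff[OF m(1) q] norm_triangle_ineq2[of "Z m" "Z q"] by linarith
  then show ?thesis
    using diff[OF p q] norm_ge_zero[of "Z q"] by linarith
qed

text \<open>Each step of length at most \<open>h\<close> costs a factor 3/2, rounded up to
  2.\<close>

lemma norm_le_power2_of_linear_growth:
  fixes Z :: "real \<Rightarrow> 'a::real_normed_vector"
  assumes deriv: "\<And>r. (Z has_vector_derivative Z' r) (at r)"
    and bound: "\<And>r. norm (Z' r) \<le> c * norm (Z r)"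
    and "c \<ge> 0" and c: "c * h \<le> 1 / 4" and "h \<ge> 0"
    and "s \<le> t" "t - s \<le> real n * h"
  shows "norm (Z t) \<le> 2 ^ n * norm (Z s)"
  using assms(6-7)
proof (induction n arbitrary: t)
  case 0
  then show ?case by simp
next
  case (Suc n)
  \<comment> \<open>The last step is shortened to start at \<open>s\<close> if less than
    \<open>h\<close> remains.\<close>
  define r where "r = max s (t - h)"
  have r: "s \<le> r" "r \<le> t" "r - s \<le> real n * h" "t - r \<le> h"
    using Suc.prems \<open>h \<ge> 0\<close> by (auto simp: r_def algebra_simps)
  have "c * (t - r) \<le> 1 / 4"
    using mult_left_mono[OF r(4) \<open>c \<ge> 0\<close>] c by linarith
  then have "norm (Z t - Z r) \<le> norm (Z r) / 2"
    using r(2) norm_diff_le_half_of_linear_growth[of r t Z Z' c t r] bound \<open>c \<ge> 0\<close>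
      has_vector_derivative_at_within[OF deriv] by auto
  then have "norm (Z t) \<le> 2 * norm (Z r)"
    using norm_triangle_ineq2[of "Z t" "Z r"] norm_ge_zero[of "Z r"] by linarith
  with Suc.IH[OF r(1,3)] show ?case by simp
qed

text \<open>Over short time intervals of uniform length the propagator is within distance \<open>1/2\<close> of the
  identity, hence of the form \<open>exp l\<close> with inverse \<open>exp (- l)\<close>; finitely many such intervals lead
  from \<open>0\<close> to \<open>t\<close>.\<close>

lemma solution_invertible:
  fixes Y :: "real \<Rightarrow> 'a::{real_normed_algebra_1, banach}"
  assumes deriv: "\<And>r. (Y has_vector_derivative C r * Y r) (at r)" and Y0: "Y 0 = 1"
    and bound: "\<And>r. norm (C r) \<le> c"
  shows "\<exists>W. W * Y t = 1 \<and> Y t * W = 1"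
proof -
  have c: "c \<ge> 0"
    using bound[of 0] norm_ge_zero order_trans by blast
  \<comment> \<open>The summand 1 keeps \<open>h\<close> positive and finite even if
    \<open>c = 0\<close>.\<close>
  define h where "h = 1 / (4 * (c + 1))"
  have h: "h > 0" "c * h \<le> 1 / 4"
    using c by (auto simp: h_def field_simps)
  have step: "\<exists>V. V * Y t = 1 \<and> Y t * V = 1"
    if W: "W * Y s = 1" "Y s * W = 1" and st: "\<bar>t - s\<bar> \<le> h" for s t W
  proof -
    define Z where "Z = (\<lambda>r. Y r * W)"
    have "(Z has_vector_derivative C r * Z r) (at r)" for r
      using has_vector_derivative_mult[OF deriv[of r] has_vector_derivative_const[of W]]
      by (simp add: Z_def mult.assoc)
    moreover have "norm (C r * Z r) \<le> c * norm (Z r)" for r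
      using norm_mult_ineq[of "C r" "Z r"] mult_right_mono[OF bound norm_ge_zero, of r "Z r"]
      by linarith
    \<comment> \<open>\<open>t\<close> may lie on either side of \<open>s\<close>.\<close>
    moreover have "c * (max s t - min s t) \<le> 1 / 4"
      using mult_left_mono[OF st c] h(2) by (auto simp: max_def min_def abs_if split: if_splits)
    ultimately have "norm (Z t - Z s) \<le> norm (Z s) / 2"
      using norm_diff_le_half_of_linear_growth[of "min s t" "max s t" Z "\<lambda>r. C r * Z r" c t s] c
      by (auto intro: has_vector_derivative_at_within)
    then have "norm (1 - Z t) < 1"
      using W by (simp add: Z_def norm_minus_commute)
    then obtain l where l: "exp l = Z t"
      using exp_log_one_minus[of "1 - Z t"] by auto
    have "Z t * Y s = Y t"
      using W by (simp add: Z_def mult.assoc)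
    then have "(W * exp (- l)) * Y t = 1" "Y t * (W * exp (- l)) = 1"
      using exp_minus_inverse[of l] exp_minus_inverse[of "- l"] W l
      by (metis (no_types, lifting) Z_def minus_minus mult.assoc mult.left_neutral)+
    then show ?thesis by blast
  qed
  have "\<exists>W. W * Y t = 1 \<and> Y t * W = 1" if "\<bar>t\<bar> \<le> real n * h" for n t
    using that
  proof (induction n arbitrary: t)
    case 0
    then show ?case using Y0 by auto
  next
    case (Suc n)
    \<comment> \<open>Shrinking \<open>t\<close> towards 0 treats both signs at once:
      \<open>s\<close> lies within \<open>n\<close> steps of 0, and \<open>t - s\<close> is
      \<open>t / real (Suc n)\<close>.\<close>
    define s where "s = t * (real n / real (Suc n))"
    have "\<bar>s\<bar> = \<bar>t\<bar> * (real n / real (Suc n))"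
      by (simp add: s_def abs_mult)
    also have "\<dots> \<le> (real (Suc n) * h) * (real n / real (Suc n))"
      using Suc.prems by (intro mult_right_mono) auto
    finally have "\<bar>s\<bar> \<le> real n * h"
      by (simp add: mult.commute)
    moreover have "\<bar>t - s\<bar> \<le> h"
    proof -
      have eq: "t - s = t / real (Suc n)"
        by (simp add: s_def field_simps)
      show ?thesis
        unfolding eq using Suc.prems by (simp add: field_simps)
    qed
    ultimately show ?case
      using Suc.IH step by blast
  qed
  moreover obtain n where "\<bar>t\<bar> / h \<le> real n"
    using real_arch_simple by blast
  ultimately show ?thesis
    using h(1) by (simp add: pos_divide_le_eq)
qed

text \<open>Integration by parts in disguise: since \<open>\<beta>\<close> is an antiderivative of \<open>b\<close>, the derivative of
  \<open>exp ((s + \<tau> - r) *\<^sub>R A) * (1 - \<beta> r) * Z r\<close> contains \<open>\<beta>\<close>, but no isolated \<open>b\<close>, and is small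
  together with \<open>\<beta>\<close>.\<close>

lemma perturbed_step_bound:
  fixes A :: "'a::{real_normed_algebra_1, banach}"
  assumes Z: "\<And>r. r \<in> {s..s+\<tau>} \<Longrightarrow>
      (Z has_vector_derivative (A + b r) * Z r) (at r within {s..s+\<tau>})"
    and \<beta>: "\<And>r. r \<in> {s..s+\<tau>} \<Longrightarrow> (\<beta> has_vector_derivative b r) (at r within {s..s+\<tau>})"
    and \<beta>0: "\<beta> s = 0" and \<beta>_le: "\<And>r. r \<in> {s..s+\<tau>} \<Longrightarrow> norm (\<beta> r) \<le> \<eta>"
    and A: "norm A \<le> M" and b: "\<And>r. r \<in> {s..s+\<tau>} \<Longrightarrow> norm (b r) \<le> M"
    and G: "\<And>r. r \<in> {s..s+\<tau>} \<Longrightarrow> norm (Z r) \<le> G * norm (Z s)"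
    and "\<tau> \<ge> 0"
  shows "norm (Z (s + \<tau>)) \<le>
    (norm (exp (\<tau> *\<^sub>R A)) + \<eta> * (G * (1 + 3 * M * \<tau> * exp (M * \<tau>)))) * norm (Z s)"
proof -
  define I where "I = {s..s+\<tau>}"
  have ends: "s \<in> I" "s + \<tau> \<in> I"
    using \<open>\<tau> \<ge> 0\<close> by (auto simp: I_def)
  have M: "M \<ge> 0"
    using A norm_ge_zero order_trans by blast
  have \<eta>: "\<eta> \<ge> 0"
    using \<beta>_le[of s] \<beta>0 ends by (simp add: I_def)
  define E where "E = (\<lambda>r. exp ((s + \<tau> - r) *\<^sub>R A))"
  define V where "V = (\<lambda>r. E r * ((1 - \<beta> r) * Z r))"
  \<comment> \<open>In the product rule the \<open>- b r\<close> coming from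
    \<open>1 - \<beta> r\<close> cancels the \<open>b r\<close> of the equation up to
    \<open>\<beta> r * b r\<close>; the terms with \<open>A\<close> leave the commutator of
    \<open>A\<close> and \<open>\<beta> r\<close>.\<close>
  define V' where "V' = (\<lambda>r. E r * ((A * \<beta> r - \<beta> r * A - \<beta> r * b r) * Z r))"
  have V: "(V has_vector_derivative V' r) (at r within I)" if r: "r \<in> I" for r
  proof -
    have "((\<lambda>r. (s + \<tau> - r) *\<^sub>R A) has_vector_derivative - A) (at r within I)"
      by (auto intro!: derivative_eq_intros)
    then have E: "(E has_vector_derivative E r * (- A)) (at r within I)"
      unfolding E_def by (rule has_vector_derivative_exp_commuting) (auto simp: r)
    have "((\<lambda>r. 1 - \<beta> r) has_vector_derivative - b r) (at r within I)"
      using \<beta>[of r] r by (auto intro!: derivative_eq_intros simp: I_def)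
    then have "((\<lambda>r. (1 - \<beta> r) * Z r) has_vector_derivative
        (1 - \<beta> r) * ((A + b r) * Z r) + (- b r) * Z r) (at r within I)"
      using Z[of r] r by (intro has_vector_derivative_mult) (auto simp: I_def)
    from has_vector_derivative_mult[OF E this] show ?thesis
      by (simp add: V_def V'_def algebra_simps)
  qed
  have V'_le: "norm (V' r) \<le> exp (M * \<tau>) * (3 * M * \<eta>) * (G * norm (Z s))" if r: "r \<in> I" for r
  proof -
    note r' = r[unfolded I_def]
    have "norm (E r) \<le> exp (norm ((s + \<tau> - r) *\<^sub>R A))"
      unfolding E_def by (rule norm_exp)
    also have "\<dots> \<le> exp (M * \<tau>)"
    proof -
      have "norm ((s + \<tau> - r) *\<^sub>R A) \<le> \<tau> * M"
        unfolding norm_scaleR using r' A \<open>\<tau> \<ge> 0\<close> by (intro mult_mono) auto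
      then show ?thesis by (simp add: mult.commute)
    qed
    finally have E: "norm (E r) \<le> exp (M * \<tau>)" .
    have "norm (A * \<beta> r) \<le> M * \<eta>" "norm (\<beta> r * A) \<le> \<eta> * M" "norm (\<beta> r * b r) \<le> \<eta> * M"
      using A b[OF r'] \<beta>_le[OF r'] M \<eta>
      by (intro order_trans[OF norm_mult_ineq] mult_mono; simp)+
    then have "norm (A * \<beta> r - \<beta> r * A - \<beta> r * b r) \<le> 3 * M * \<eta>"
      using norm_triangle_ineq4[of "A * \<beta> r - \<beta> r * A" "\<beta> r * b r"]
        norm_triangle_ineq4[of "A * \<beta> r" "\<beta> r * A"] by (simp only: mult.commute[of \<eta>])
    then have "norm ((A * \<beta> r - \<beta> r * A - \<beta> r * b r) * Z r) \<le> (3 * M * \<eta>) * (G * norm (Z s))"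
      using G[OF r'] M \<eta> by (intro order_trans[OF norm_mult_ineq] mult_mono) auto
    then have "norm (V' r) \<le> exp (M * \<tau>) * ((3 * M * \<eta>) * (G * norm (Z s)))"
      unfolding V'_def by (rule order_trans[OF norm_mult_ineq mult_mono[OF E]]) auto
    then show ?thesis
      by (simp only: mult.assoc)
  qed
  have "norm (V (s + \<tau>) - V s) \<le> exp (M * \<tau>) * (3 * M * \<eta>) * (G * norm (Z s)) * norm (s + \<tau> - s)"
  proof (rule differentiable_bound[of I V "\<lambda>r h. h *\<^sub>R V' r"])
    show "onorm (\<lambda>h. h *\<^sub>R V' r) \<le> exp (M * \<tau>) * (3 * M * \<eta>) * (G * norm (Z s))" if "r \<in> I" for r
    proof (rule onorm_le)
      show "norm (h *\<^sub>R V' r) \<le> exp (M * \<tau>) * (3 * M * \<eta>) * (G * norm (Z s)) * norm h" for h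
        using mult_left_mono[OF V'_le[OF that], of "\<bar>h\<bar>"] by (simp add: mult_ac)
    qed
  qed (use V ends in \<open>auto simp: has_vector_derivative_def I_def\<close>)
  moreover have "V (s + \<tau>) = (1 - \<beta> (s + \<tau>)) * Z (s + \<tau>)" "V s = exp (\<tau> *\<^sub>R A) * Z s"
    by (simp_all add: V_def E_def \<beta>0)
  moreover have "norm (exp (\<tau> *\<^sub>R A) * Z s) \<le> norm (exp (\<tau> *\<^sub>R A)) * norm (Z s)"
    by (rule norm_mult_ineq)
  moreover have "norm (\<beta> (s + \<tau>) * Z (s + \<tau>)) \<le> \<eta> * (G * norm (Z s))"
    using \<beta>_le G ends \<eta> by (intro order_trans[OF norm_mult_ineq] mult_mono) (auto simp: I_def)
  \<comment> \<open>Accumulated error, main term \<open>V s\<close>, and a boundary term that undoes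
    the factor \<open>1 - \<beta>\<close> at the end point.\<close>
  moreover have "Z (s + \<tau>) = (V (s + \<tau>) - V s) + V s + \<beta> (s + \<tau>) * Z (s + \<tau>)"
    using calculation(2) by (simp add: algebra_simps)
  ultimately have "norm (Z (s + \<tau>)) \<le> exp (M * \<tau>) * (3 * M * \<eta>) * (G * norm (Z s)) * \<tau>
      + norm (exp (\<tau> *\<^sub>R A)) * norm (Z s) + \<eta> * (G * norm (Z s))"
    using norm_triangle_ineq[of "(V (s + \<tau>) - V s) + V s" "\<beta> (s + \<tau>) * Z (s + \<tau>)"]
      norm_triangle_ineq[of "V (s + \<tau>) - V s" "V s"] \<open>\<tau> \<ge> 0\<close> by simp
  then show ?thesis
    by (simp add: algebra_simps)
qed

text \<open>The witness is the integral of \<open>B\<close> from \<open>\<omega> * s\<close> to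
  \<open>\<omega> * r\<close>, divided by \<open>\<omega>\<close>. Over long intervals the mean
  value makes it small, over short ones the factor \<open>1 / \<omega>\<close> does. The mean value
  is approached uniformly in the starting point, so \<open>\<omega>0\<close> can be chosen
  independently of \<open>s\<close>.\<close>

lemma mean_value_zero_antiderivative:
  fixes B :: "real \<Rightarrow> 'b::banach"
  assumes cont: "continuous_on UNIV B" and bound: "\<And>t. norm (B t) \<le> M" and "M > 0"
    and mean: "has_mean_value B 0" and "\<eta> > 0" "\<tau> > 0"
  obtains \<omega>0 where "\<omega>0 > 0"
    "\<And>\<omega> s. \<omega> > \<omega>0 \<Longrightarrow> \<exists>\<beta>. \<beta> s = 0 \<and> (\<forall>r\<in>{s..s+\<tau>}.
        (\<beta> has_vector_derivative B (\<omega> * r)) (at r within {s..s+\<tau>}) \<and> norm (\<beta> r) \<le> \<eta>)"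
proof -
  have "\<eta> / \<tau> > 0"
    using assms by simp
  \<comment> \<open>The accuracy \<open>\<eta> / \<tau>\<close> allows for the later factor
    \<open>r - s\<close>, which is at most \<open>\<tau>\<close>.\<close>
  then obtain T0 where T0: "T0 > 0"
    "\<And>T s. T \<ge> T0 \<Longrightarrow> norm ((1 / T) *\<^sub>R integral {s..s+T} B) < \<eta> / \<tau>"
    using mean unfolding has_mean_value_def by (metis diff_zero)
  show ?thesis
  proof
    \<comment> \<open>Beyond this threshold \<open>M * T0 / \<omega>\<close> is below
      \<open>\<eta>\<close>, which settles the intervals shorter than \<open>T0\<close>.\<close>
    show "M * T0 / \<eta> > 0"
      using assms T0 by simp
    fix \<omega> s :: real
    assume \<omega>: "\<omega> > M * T0 / \<eta>"
    with \<open>M * T0 / \<eta> > 0\<close> have "\<omega> > 0" by linarith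
    define \<beta> where "\<beta> = (\<lambda>r. (1 / \<omega>) *\<^sub>R integral {\<omega> * s..\<omega> * r} B)"
    have contB: "continuous_on S B" for S
      using cont continuous_on_subset by blast
    have deriv: "(\<beta> has_vector_derivative B (\<omega> * r)) (at r within {s..s+\<tau>})"
      if r: "r \<in> {s..s+\<tau>}" for r
    proof -
      have im: "(\<lambda>r. \<omega> * r) ` {s..s+\<tau>} \<subseteq> {\<omega> * s..\<omega> * (s + \<tau>)}"
        using \<open>\<omega> > 0\<close> by auto
      then have "((\<lambda>u. integral {\<omega> * s..u} B) has_vector_derivative B (\<omega> * r))
          (at (\<omega> * r) within (\<lambda>r. \<omega> * r) ` {s..s+\<tau>})"
        using integral_has_vector_derivative[OF contB] r
        by (metis has_vector_derivative_within_subset image_subset_iff)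
      moreover have "((\<lambda>r. \<omega> * r) has_vector_derivative \<omega>) (at r within {s..s+\<tau>})"
        by (auto intro!: derivative_eq_intros)
      ultimately have "((\<lambda>r. integral {\<omega> * s..\<omega> * r} B) has_vector_derivative \<omega> *\<^sub>R B (\<omega> * r))
          (at r within {s..s+\<tau>})"
        using vector_diff_chain_within[of "\<lambda>r. \<omega> * r"] by (simp add: o_def)
      from bounded_linear.has_vector_derivative[OF bounded_linear_scaleR_right this, of "1 / \<omega>"]
      show ?thesis
        using \<open>\<omega> > 0\<close> by (simp add: \<beta>_def)
    qed
    have le: "norm (\<beta> r) \<le> \<eta>" if r: "r \<in> {s..s+\<tau>}" for r
    proof (cases "\<omega> * (r - s) \<ge> T0")
      case True
      have pos: "\<omega> * (r - s) > 0"
        using True T0(1) by linarith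
      then have "r - s > 0"
        using \<open>\<omega> > 0\<close> zero_less_mult_pos by blast
      have "\<omega> * s + \<omega> * (r - s) = \<omega> * r" "(r - s) * (1 / (\<omega> * (r - s))) = 1 / \<omega>"
        using \<open>r - s > 0\<close> by (simp add: algebra_simps) (use pos \<open>r - s > 0\<close> in simp)
      then have "\<beta> r =
          (r - s) *\<^sub>R ((1 / (\<omega> * (r - s))) *\<^sub>R integral {\<omega> * s..\<omega> * s + \<omega> * (r - s)} B)"
        by (simp only: \<beta>_def scaleR_scaleR)
      then have "norm (\<beta> r) =
          (r - s) * norm ((1 / (\<omega> * (r - s))) *\<^sub>R integral {\<omega> * s..\<omega> * s + \<omega> * (r - s)} B)"
        using \<open>r - s > 0\<close> by (metis abs_of_pos norm_scaleR)
      also have "\<dots> \<le> \<tau> * (\<eta> / \<tau>)"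
        using T0(2)[OF True, of "\<omega> * s"] r \<open>\<tau> > 0\<close> by (intro mult_mono) auto
      finally show ?thesis
        using \<open>\<tau> > 0\<close> by simp
    next
      case False
      have "norm (integral {\<omega> * s..\<omega> * r} B) \<le> M * (\<omega> * r - \<omega> * s)"
        using r \<open>\<omega> > 0\<close> bound contB by (intro integral_bound) auto
      also have "\<dots> \<le> M * T0"
        using False \<open>M > 0\<close> by (intro mult_left_mono) (auto simp: right_diff_distrib)
      also have "\<dots> \<le> \<eta> * \<omega>"
        using \<omega> \<open>\<eta> > 0\<close> by (simp add: field_simps)
      finally show ?thesis
        using \<open>\<omega> > 0\<close> by (simp add: \<beta>_def field_simps)
    qed
    show "\<exists>\<beta>. \<beta> s = 0 \<and> (\<forall>r\<in>{s..s+\<tau>}.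
        (\<beta> has_vector_derivative B (\<omega> * r)) (at r within {s..s+\<tau>}) \<and> norm (\<beta> r) \<le> \<eta>)"
      using deriv le by (intro exI[of _ \<beta>]) (auto simp: \<beta>_def)
  qed
qed

text \<open>Each step of length \<open>\<tau>\<close> halves the norm, which gives the rate
  \<open>ln 2 / \<tau>\<close>. The constants are chosen before \<open>Z\<close> and
  \<open>s\<close>, so the estimate applies to the fundamental solution normalised at any
  time.\<close>

theorem averaging_stability:
  fixes A :: "'a::{real_normed_algebra_1, banach}"
  assumes cont: "continuous_on UNIV B" and bound: "\<And>t. norm (B t) \<le> M" and "M > 0"
    and A: "norm A \<le> M" and mean: "has_mean_value B 0"
    and "\<tau> > 0" and \<tau>: "norm (exp (\<tau> *\<^sub>R A)) \<le> 1 / 4"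
  shows "\<exists>K>0. \<exists>\<alpha>>0. \<exists>\<omega>0>0. \<forall>\<omega>>\<omega>0. \<forall>Z.
    (\<forall>r. (Z has_vector_derivative (A + B (\<omega> * r)) * Z r) (at r)) \<longrightarrow>
      (\<forall>s t. s \<le> t \<longrightarrow> norm (Z t) \<le> K * exp (- \<alpha> * (t - s)) * norm (Z s))"
proof -
  \<comment> \<open>The coefficient has norm at most \<open>2 * M\<close>; this step length yields
    the \<open>1 / 4\<close> that the growth lemma requires.\<close>
  define h where "h = 1 / (8 * M)"
  have h: "h > 0" "2 * M * h \<le> 1 / 4"
    using \<open>M > 0\<close> by (auto simp: h_def)
  obtain n where "\<tau> / h \<le> real n"
    using real_arch_simple by blast
  then have n: "\<tau> \<le> real n * h"
    using h(1) by (simp add: pos_divide_le_eq)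
  define G :: real where "G = 2 ^ n"
  have "G > 0" by (simp add: G_def)
  define c where "c = G * (1 + 3 * M * \<tau> * exp (M * \<tau>))"
  have "c > 0"
    unfolding c_def using \<open>G > 0\<close> \<open>M > 0\<close> \<open>\<tau> > 0\<close> by (intro mult_pos_pos add_pos_pos) auto
  \<comment> \<open>\<open>c\<close> is the factor of \<open>\<eta>\<close> in
    \<open>perturbed_step_bound\<close>. The error becomes \<open>1 / 4\<close>, and together with
    the \<open>1 / 4\<close> from \<open>exp (\<tau> *\<^sub>R A)\<close> the norm is
    halved.\<close>
  define \<eta> where "\<eta> = 1 / (4 * c)"
  have \<eta>: "\<eta> > 0" "\<eta> * c = 1 / 4"
    using \<open>c > 0\<close> by (auto simp: \<eta>_def)
  obtain \<omega>0 where \<omega>0: "\<omega>0 > 0"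
    "\<And>\<omega> s. \<omega> > \<omega>0 \<Longrightarrow> \<exists>\<beta>. \<beta> s = 0 \<and> (\<forall>r\<in>{s..s+\<tau>}.
        (\<beta> has_vector_derivative B (\<omega> * r)) (at r within {s..s+\<tau>}) \<and> norm (\<beta> r) \<le> \<eta>)"
    using mean_value_zero_antiderivative[OF cont bound \<open>M > 0\<close> mean \<eta>(1) \<open>\<tau> > 0\<close>] by metis
  have main: "norm (Z t) \<le> 2 * G * exp (- (ln 2 / \<tau>) * (t - s)) * norm (Z s)"
    if "\<omega> > \<omega>0" and Z: "\<And>r. (Z has_vector_derivative (A + B (\<omega> * r)) * Z r) (at r)" and "s \<le> t"
    for \<omega> Z s t
  proof -
    have growth: "norm (Z r) \<le> G * norm (Z s)" if "r \<in> {s..s+\<tau>}" for r s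
      unfolding G_def
    proof (rule norm_le_power2_of_linear_growth[OF Z])
      show "norm ((A + B (\<omega> * r)) * Z r) \<le> 2 * M * norm (Z r)" for r
        using norm_triangle_ineq[of A "B (\<omega> * r)"] A bound[of "\<omega> * r"]
        by (intro order_trans[OF norm_mult_ineq] mult_right_mono) auto
    qed (use h n that \<open>M > 0\<close> in auto)
    have step: "norm (Z (s + \<tau>)) \<le> norm (Z s) / 2" for s
    proof -
      obtain \<beta> where \<beta>: "\<beta> s = 0" "\<And>r. r \<in> {s..s+\<tau>} \<Longrightarrow>
          (\<beta> has_vector_derivative B (\<omega> * r)) (at r within {s..s+\<tau>})"
          "\<And>r. r \<in> {s..s+\<tau>} \<Longrightarrow> norm (\<beta> r) \<le> \<eta>"
        using \<omega>0(2)[OF \<open>\<omega> > \<omega>0\<close>] by blast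
      have "norm (Z (s + \<tau>)) \<le> (norm (exp (\<tau> *\<^sub>R A)) + \<eta> * c) * norm (Z s)"
        unfolding c_def
        by (rule perturbed_step_bound[OF has_vector_derivative_at_within[OF Z] \<beta>(2,1,3) A bound growth])
          (use \<open>\<tau> > 0\<close> in auto)
      also have "\<dots> \<le> (1 / 2) * norm (Z s)"
        using \<tau> \<eta>(2) by (intro mult_right_mono) auto
      finally show ?thesis by simp
    qed
    have steps: "norm (Z (s + real k * \<tau>)) \<le> (1 / 2) ^ k * norm (Z s)" for k
    proof (induction k)
      case (Suc k)
      then show ?case
        using step[of "s + real k * \<tau>"] by (simp add: algebra_simps)
    qed simp
    \<comment> \<open>The number of whole steps between \<open>s\<close> and \<open>t\<close>; the
      remaining time is covered by \<open>growth\<close>.\<close>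
    define k where "k = nat \<lfloor>(t - s) / \<tau>\<rfloor>"
    have "(t - s) / \<tau> \<ge> 0"
      using \<open>s \<le> t\<close> \<open>\<tau> > 0\<close> by simp
    then have "real k \<le> (t - s) / \<tau>" and k1: "(t - s) / \<tau> \<le> real k + 1"
      unfolding k_def by linarith+
    then have "s + real k * \<tau> \<le> t" "t \<le> s + real k * \<tau> + \<tau>"
      using \<open>\<tau> > 0\<close> by (simp_all add: field_simps)
    then have "norm (Z t) \<le> G * norm (Z (s + real k * \<tau>))"
      by (intro growth) auto
    also have "\<dots> \<le> G * ((1 / 2) ^ k * norm (Z s))"
      using steps[of k] \<open>G > 0\<close> by (intro mult_left_mono) auto
    also have "(1 / 2 :: real) ^ k = exp (- ln 2 * real k)"
      by (simp add: exp_of_nat_mult power_one_over exp_minus mult.commute inverse_eq_divide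
          flip: power_inverse)
    \<comment> \<open>Rounding down loses at most one halving, hence the factor 2 in the constant
      \<open>2 * G\<close>.\<close>
    also have "\<dots> \<le> exp (ln 2 - (ln 2 / \<tau>) * (t - s))"
    proof -
      have "ln 2 * ((t - s) / \<tau>) \<le> ln 2 * (real k + 1)"
        using k1 by (intro mult_left_mono) auto
      then show ?thesis
        by (simp add: algebra_simps)
    qed
    also have "\<dots> = 2 * exp (- (ln 2 / \<tau>) * (t - s))"
      by (simp add: exp_diff exp_minus inverse_eq_divide)
    finally show ?thesis
      using \<open>G > 0\<close> by (simp add: mult_ac mult_left_mono mult_right_mono)
  qed
  show ?thesis
  proof (rule exI[of _ "2 * G"], rule conjI[OF _ exI[of _ "ln 2 / \<tau>"]], goal_cases)
    case 2
    show ?case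
      using main \<omega>0(1) \<open>\<tau> > 0\<close> by (intro conjI exI[of _ \<omega>0]) auto
  qed (use \<open>G > 0\<close> in auto)
qed

subsection \<open>The Banach algebra of operators\<close>

text \<open>Expresses that the space is not trivial, so that the identity operator has norm 1, as
  \<open>real_normed_algebra_1\<close> demands. Small multiples of the first unit vector lead to
  other points near \<open>x\<close>.\<close>

instance ell2 :: (real_normed_field) perfect_space
proof
  fix x :: "'a ell2"
  show "\<not> open {x}"
  proof
    assume "open {x}"
    then obtain e where e: "e > 0" "ball x e \<subseteq> {x}"
      by (meson open_contains_ball insertI1)
    define y where "y = x + (e / 2) *\<^sub>R ell2_cons 1 0"
    have "norm (ell2_cons 1 0 :: 'a ell2) = 1"
      by (simp add: norm_ell2_cons)
    then have "dist x y = e / 2"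
      using e(1) by (simp add: y_def dist_norm)
    with e show False
      by (metis dist_self field_sum_of_halves half_gt_zero less_add_same_cancel2 less_irrefl
          mem_ball singletonD subsetD)
  qed
qed

text \<open>A copy of \<open>'a \<Rightarrow>\<^sub>L 'a\<close>, because a type class instance for the binary type constructor of
  \<open>'a \<Rightarrow>\<^sub>L 'b\<close> cannot be restricted to the diagonal \<open>'a = 'b\<close>.\<close>

typedef (overloaded) 'a endo = "UNIV :: ('a::{banach, perfect_space} \<Rightarrow>\<^sub>L 'a) set"
  morphisms blinfun_of_endo endo_of_blinfun
  by simp

setup_lifting type_definition_endo

instantiation endo :: ("{banach, perfect_space}") real_normed_algebra_1
begin

lift_definition zero_endo :: "'a endo" is 0 .
lift_definition one_endo :: "'a endo" is id_blinfun .
lift_definition plus_endo :: "'a endo \<Rightarrow> 'a endo \<Rightarrow> 'a endo" is plus .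
lift_definition minus_endo :: "'a endo \<Rightarrow> 'a endo \<Rightarrow> 'a endo" is minus .
lift_definition uminus_endo :: "'a endo \<Rightarrow> 'a endo" is uminus .
lift_definition times_endo :: "'a endo \<Rightarrow> 'a endo \<Rightarrow> 'a endo" is "(o\<^sub>L)" .
lift_definition scaleR_endo :: "real \<Rightarrow> 'a endo \<Rightarrow> 'a endo" is scaleR .
lift_definition norm_endo :: "'a endo \<Rightarrow> real" is norm .

definition dist_endo :: "'a endo \<Rightarrow> 'a endo \<Rightarrow> real" where
  "dist_endo x y = norm (x - y)"
definition sgn_endo :: "'a endo \<Rightarrow> 'a endo" where
  "sgn_endo x = inverse (norm x) *\<^sub>R x"
definition uniformity_endo :: "('a endo \<times> 'a endo) filter" where
  "uniformity_endo = (INF e\<in>{0<..}. principal {(x, y). dist x y < e})"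
definition open_endo :: "'a endo set \<Rightarrow> bool" where
  "open_endo U = (\<forall>x\<in>U. \<forall>\<^sub>F (x', y) in uniformity. x' = x \<longrightarrow> y \<in> U)"

instance
proof
  fix x y z :: "'a endo" and r s :: real and U :: "'a endo set"
  show "x + y + z = x + (y + z)" by transfer (simp add: add.assoc)
  show "x + y = y + x" by transfer (simp add: add.commute)
  show "0 + x = x" by transfer simp
  show "- x + x = 0" by transfer simp
  show "x - y = x + - y" by transfer simp
  show "r *\<^sub>R (x + y) = r *\<^sub>R x + r *\<^sub>R y" by transfer (simp add: scaleR_add_right)
  show "(r + s) *\<^sub>R x = r *\<^sub>R x + s *\<^sub>R x" by transfer (simp add: scaleR_add_left)
  show "r *\<^sub>R s *\<^sub>R x = (r * s) *\<^sub>R x" by transfer simp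
  show "1 *\<^sub>R x = x" by transfer simp
  show "dist x y = norm (x - y)" by (rule dist_endo_def)
  show "sgn x = inverse (norm x) *\<^sub>R x" by (rule sgn_endo_def)
  show "uniformity = (INF e\<in>{0<..}. principal {(x :: 'a endo, y). dist x y < e})"
    by (rule uniformity_endo_def)
  show "open U = (\<forall>x\<in>U. \<forall>\<^sub>F (x', y) in uniformity. x' = x \<longrightarrow> y \<in> U)"
    by (rule open_endo_def)
  show "norm x = 0 \<longleftrightarrow> x = 0" by transfer simp
  show "norm (x + y) \<le> norm x + norm y" by transfer (rule norm_triangle_ineq)
  show "norm (r *\<^sub>R x) = \<bar>r\<bar> * norm x" by transfer simp
  show "x * y * z = x * (y * z)" by transfer (simp add: blinfun_eqI)
  show "(x + y) * z = x * z + y * z"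
    by transfer (rule bounded_bilinear.add_left[OF bounded_bilinear_blinfun_compose])
  show "x * (y + z) = x * y + x * z"
    by transfer (rule bounded_bilinear.add_right[OF bounded_bilinear_blinfun_compose])
  show "r *\<^sub>R x * y = r *\<^sub>R (x * y)"
    by transfer (rule bounded_bilinear.scaleR_left[OF bounded_bilinear_blinfun_compose])
  show "x * r *\<^sub>R y = r *\<^sub>R (x * y)"
    by transfer (rule bounded_bilinear.scaleR_right[OF bounded_bilinear_blinfun_compose])
  show "1 * x = x" by transfer (simp add: blinfun_eqI)
  show "x * 1 = x" by transfer (simp add: blinfun_eqI)
  show "(0 :: 'a endo) \<noteq> 1" by transfer (metis norm_blinfun_id norm_zero zero_neq_one)
  show "norm (x * y) \<le> norm x * norm y" by transfer (rule norm_blinfun_compose)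
  show "norm (1 :: 'a endo) = 1" by transfer simp
qed

end

lemma bounded_linear_blinfun_of_endo: "bounded_linear blinfun_of_endo"
  by (rule bounded_linear_intro[where K=1])
    (simp_all add: plus_endo.rep_eq scaleR_endo.rep_eq norm_endo.rep_eq)

lemma bounded_linear_endo_of_blinfun: "bounded_linear endo_of_blinfun"
  by (rule bounded_linear_intro[where K=1])
    (simp_all add: plus_endo.abs_eq scaleR_endo.abs_eq norm_endo.abs_eq)

instance endo :: ("{banach, perfect_space}") banach
proof
  fix X :: "nat \<Rightarrow> 'a endo"
  assume "Cauchy X"
  then have "Cauchy (\<lambda>n. blinfun_of_endo (X n))"
    by (rule bounded_linear.Cauchy[OF bounded_linear_blinfun_of_endo])
  then obtain l where "(\<lambda>n. blinfun_of_endo (X n)) \<longlonglongrightarrow> l"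
    using Cauchy_convergent convergent_def by blast
  then have "(\<lambda>n. endo_of_blinfun (blinfun_of_endo (X n))) \<longlonglongrightarrow> endo_of_blinfun l"
    by (rule bounded_linear.tendsto[OF bounded_linear_endo_of_blinfun])
  then show "convergent X"
    by (simp add: blinfun_of_endo_inverse convergentI)
qed

lemma blinfun_power_eq: "endo_of_blinfun (blinfun_power T n) = endo_of_blinfun T ^ n"
  unfolding blinfun_power_def
  by (induction n) (simp_all add: one_endo_def flip: times_endo.abs_eq)

subsection \<open>The operator \<open>A\<close>\<close>

text \<open>The operator drops the first coordinate and applies an isometry to the rest.\<close>

lemma norm_block_diag_right_shift_le:
  "norm (block_diag 0 right_shift :: 'a::real_normed_vector ell2 \<Rightarrow>\<^sub>L 'a ell2) \<le> 1"
proof (rule norm_blinfun_bound)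
  show "norm (blinfun_apply (block_diag 0 right_shift) x) \<le> 1 * norm x" for x :: "'a ell2"
    using norm_ell2_tl_le[of x] by (simp add: block_diag.rep_eq right_shift.rep_eq norm_ell2_cons)
qed simp

lemma norm_D_op_le:
  assumes "0 < a" "0 < \<nu>"
  shows "norm (D_op a \<nu> :: 'a::real_normed_vector ell2 \<Rightarrow>\<^sub>L 'a ell2) \<le> \<nu> / a"
  using assms mult_left_mono[OF norm_block_diag_right_shift_le, of "\<nu> / a"]
  by (simp add: D_op_def)

text \<open>The triangle inequality in the factorisation \<open>L_op_eq\<close>.\<close>

lemma norm_L_op_le:
  assumes "0 < a" "0 < \<nu>"
  shows "norm (L_op a \<nu> :: 'a::real_normed_vector ell2 \<Rightarrow>\<^sub>L 'a ell2) \<le> a + \<nu>"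
proof -
  have "norm (id_blinfun - D_op a \<nu> :: 'a ell2 \<Rightarrow>\<^sub>L 'a ell2) \<le> 1 + \<nu> / a"
    using norm_triangle_ineq4[of id_blinfun "D_op a \<nu> :: 'a ell2 \<Rightarrow>\<^sub>L 'a ell2"]
      norm_D_op_le[OF assms, where ?'a = 'a] norm_blinfun_id_le[where ?'a = "'a ell2"] by linarith
  then have "a * norm (id_blinfun - D_op a \<nu> :: 'a ell2 \<Rightarrow>\<^sub>L 'a ell2) \<le> a * (1 + \<nu> / a)"
    using assms by (intro mult_left_mono) auto
  then show ?thesis
    using assms by (simp add: L_op_eq distrib_left)
qed

text \<open>A bounded linear map commutes with convergent series. Convergence on the operator side
  is pulled back through \<open>blinfun_of_endo\<close>.\<close>

lemma endo_of_blinfun_log_id_minus: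
  assumes "norm T < 1"
  shows "endo_of_blinfun (log_id_minus T) = log_one_minus (endo_of_blinfun T)"
proof -
  interpret e: bounded_linear endo_of_blinfun
    by (rule bounded_linear_endo_of_blinfun)
  interpret b: bounded_linear blinfun_of_endo
    by (rule bounded_linear_blinfun_of_endo)
  have "blinfun_of_endo ((1 / real (Suc n)) *\<^sub>R endo_of_blinfun T ^ Suc n) =
      (1 / real (Suc n)) *\<^sub>R blinfun_power T (Suc n)" for n
    using blinfun_power_eq[of T "Suc n"]
    by (metis b.scaleR endo_of_blinfun_inverse UNIV_I)
  then have "summable (\<lambda>n. (1 / real (Suc n)) *\<^sub>R blinfun_power T (Suc n))"
    using b.summable[OF summable_log_one_minus[of "endo_of_blinfun T"]] assms
    by (simp add: norm_endo.abs_eq del: power_Suc of_nat_Suc)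
  from e.suminf[OF this] show ?thesis
    by (simp add: log_id_minus_def log_one_minus_def e.neg e.scaleR blinfun_power_eq
        del: power_Suc of_nat_Suc)
qed

text \<open>The scalar part \<open>ln a\<close> commutes with the logarithm, so the exponential
  factors into \<open>a\<close> and \<open>1 - D\<close>; \<open>\<nu> < a\<close> ensures
  \<open>norm D < 1\<close>.\<close>

lemma exp_A_op:
  assumes "0 < a" "0 < \<nu>" "\<nu> < a"
  shows "exp (endo_of_blinfun (A_op a \<nu>)) =
    (endo_of_blinfun (L_op a \<nu>) :: 'k::{real_normed_field, banach} ell2 endo)"
proof -
  interpret e: bounded_linear "endo_of_blinfun :: _ \<Rightarrow> 'k ell2 endo"
    by (rule bounded_linear_endo_of_blinfun)
  define D :: "'k ell2 endo" where "D = endo_of_blinfun (D_op a \<nu>)"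
  have D: "norm (D_op a \<nu> :: 'k ell2 \<Rightarrow>\<^sub>L 'k ell2) < 1"
  proof -
    have "\<nu> / a < 1" using assms by simp
    then show ?thesis
      using norm_D_op_le[OF assms(1,2), where ?'a = 'k] by linarith
  qed
  then have "endo_of_blinfun (A_op a \<nu>) = of_real (ln a) + log_one_minus D"
    by (simp add: A_op_def e.add e.scaleR endo_of_blinfun_log_id_minus D_def of_real_def
        one_endo_def)
  then have "exp (endo_of_blinfun (A_op a \<nu>)) = exp (of_real (ln a)) * exp (log_one_minus D)"
    by (simp add: exp_add_commuting of_real_def)
  also have "\<dots> = a *\<^sub>R (1 - D)"
    using D assms by (simp add: exp_log_one_minus D_def norm_endo.abs_eq exp_of_real
        scaleR_conv_of_real)
  also have "\<dots> = endo_of_blinfun (L_op a \<nu>)"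
    using assms by (simp add: L_op_eq e.scaleR e.diff D_def one_endo_def)
  finally show ?thesis .
qed

section \<open>Transfer of the stability estimate to the evolution operator\<close>

lemma blinfun_inv_eqI:
  assumes "W o\<^sub>L T = id_blinfun" "T o\<^sub>L W = id_blinfun"
  shows "blinfun_inv T = W"
  unfolding blinfun_inv_def
proof (rule the_equality)
  fix S
  assume S: "S o\<^sub>L T = id_blinfun \<and> T o\<^sub>L S = id_blinfun"
  have "S = S o\<^sub>L (T o\<^sub>L W)"
    using assms by (simp add: blinfun_eqI)
  also have "\<dots> = (S o\<^sub>L T) o\<^sub>L W"
    by (simp add: blinfun_eqI)
  also have "\<dots> = W"
    using S by (simp add: blinfun_eqI)
  finally show "S = W" .
qed (use assms in auto)

text \<open>\<open>endo_of_blinfun\<close> is a linear isometry that turns composition into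
  multiplication, so the hypotheses carry over to \<open>'k ell2 endo\<close> and the estimate
  carries back.\<close>

theorem corollary4:
  fixes a \<nu> M :: real
    and B :: "real \<Rightarrow> 'k::{real_normed_field, banach} ell2 \<Rightarrow>\<^sub>L 'k ell2"
  assumes "0 < a" "a < 1"
    and "0 < \<nu>" "\<nu> < min a (1 - a)"
    and "0 < - ln (1 - \<nu> / a)" "- ln (1 - \<nu> / a) < a / 2"
    and "generalized_almost_periodic B" "has_mean_value B 0"
    and "M > 0"
    and "norm (A_op a \<nu> :: 'k ell2 \<Rightarrow>\<^sub>L 'k ell2) \<le> M"
    and "(SUP t. norm (B t)) \<le> M"
  shows "\<exists>K>0. \<exists>\<alpha>>0. \<exists>\<omega>0>0. \<forall>\<omega>>\<omega>0.
           \<forall>Y. operator_solution (\<lambda>t. A_op a \<nu> + B (\<omega> * t)) Y \<longrightarrow>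
             (\<forall>t s. t \<ge> s \<longrightarrow>
               norm (evolution_operator Y t s) \<le> K * exp (- \<alpha> * (t - s)))"
proof -
  interpret e: bounded_linear "endo_of_blinfun :: _ \<Rightarrow> 'k ell2 endo"
    by (rule bounded_linear_endo_of_blinfun)
  define A :: "'k ell2 endo" where "A = endo_of_blinfun (A_op a \<nu>)"
  define B' :: "real \<Rightarrow> 'k ell2 endo" where "B' = (\<lambda>t. endo_of_blinfun (B t))"
  have A: "norm A \<le> M"
    using assms(10) by (simp add: A_def norm_endo.abs_eq)
  have gap: "bounded (range B)" "uniformly_continuous_on UNIV B"
    using assms(7) by (auto simp: generalized_almost_periodic_def bounded_ucont_precompact_def)
  have contB: "continuous_on UNIV B"
    using gap(2) by (rule uniformly_continuous_imp_continuous)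
  have cont: "continuous_on UNIV B'"
    unfolding B'_def by (rule e.continuous_on[OF contB])
  have bound: "norm (B' t) \<le> M" for t
  proof -
    \<comment> \<open>The supremum bounds the single values only because the range is
      bounded.\<close>
    have "bdd_above (range (\<lambda>t. norm (B t)))"
      using gap(1) by (auto simp: bounded_iff bdd_above_def)
    then have "norm (B t) \<le> (SUP t. norm (B t))"
      by (rule cSUP_upper[OF UNIV_I])
    then show ?thesis
      using assms(11) by (simp add: B'_def norm_endo.abs_eq)
  qed
  have mean: "has_mean_value B' 0"
  proof -
    have "integral {s..s+T} B' = endo_of_blinfun (integral {s..s+T} B)" for s T
      using integral_linear[OF integrable_continuous_real bounded_linear_endo_of_blinfun,
          of s "s + T" B]
        continuous_on_subset[OF contB] by (auto simp: B'_def o_def)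
    then have "norm ((1 / T) *\<^sub>R integral {s..s+T} B' - 0) =
        norm ((1 / T) *\<^sub>R integral {s..s+T} B - 0)" for s T
      by (simp add: norm_endo.abs_eq)
    then show ?thesis
      using assms(8) by (simp only: has_mean_value_def)
  qed
  \<comment> \<open>By \<open>\<nu> < 1 - a\<close>, \<open>L\<close> is a strict contraction; a
    power of it with norm below \<open>1 / 4\<close> is the exponential of \<open>A\<close> at the
    time \<open>\<tau> = n\<close>.\<close>
  have "a + \<nu> < 1"
    using assms(4) by simp
  then obtain n where n: "(a + \<nu>) ^ n < 1 / 4"
    using real_arch_pow_inv[of "1 / 4" "a + \<nu>"] by auto
  \<comment> \<open>The zeroth power would be 1, which is not below \<open>1 / 4\<close>.\<close>
  have "n > 0"
    using n by (cases n) auto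
  have "norm (exp (real n *\<^sub>R A)) \<le> 1 / 4"
  proof -
    have "exp (real n *\<^sub>R A) = exp A ^ n"
      by (rule exp_scaleR_of_nat)
    also have "norm \<dots> \<le> norm (exp A) ^ n"
      by (rule norm_power_ineq)
    also have "\<dots> \<le> (a + \<nu>) ^ n"
      using assms(1-4) exp_A_op[of a \<nu>, where ?'k = 'k] norm_L_op_le[of a \<nu>, where ?'a = 'k]
      by (intro power_mono) (auto simp: A_def norm_endo.abs_eq)
    finally show ?thesis
      using n by simp
  qed
  then obtain K \<alpha> \<omega>0 where pos: "K > 0" "\<alpha> > 0" "\<omega>0 > 0"
    and decay: "\<And>\<omega> Z s t. \<omega> > \<omega>0 \<Longrightarrow> (\<And>r. (Z has_vector_derivative (A + B' (\<omega> * r)) * Z r) (at r)) \<Longrightarrow>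
      s \<le> t \<Longrightarrow> norm (Z t) \<le> K * exp (- \<alpha> * (t - s)) * norm (Z s)"
    using averaging_stability[OF cont bound \<open>M > 0\<close> A mean, of "real n"] \<open>n > 0\<close> by auto
  have "norm (evolution_operator Y t s) \<le> K * exp (- \<alpha> * (t - s))"
    if \<omega>: "\<omega> > \<omega>0" and Y: "operator_solution (\<lambda>t. A_op a \<nu> + B (\<omega> * t)) Y"
      and st: "s \<le> t" for \<omega> Y s t
  proof -
    define X where "X = (\<lambda>r. endo_of_blinfun (Y r))"
    have X: "(X has_vector_derivative (A + B' (\<omega> * r)) * X r) (at r)" for r
    proof -
      have "(Y has_vector_derivative (A_op a \<nu> + B (\<omega> * r)) o\<^sub>L Y r) (at r)"
        using Y by (simp add: operator_solution_def)
      from bounded_linear.has_vector_derivative[OF bounded_linear_endo_of_blinfun this]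
      show ?thesis
        by (simp add: X_def A_def B'_def times_endo.abs_eq plus_endo.abs_eq)
    qed
    have "X 0 = 1"
      using Y by (simp add: X_def operator_solution_def one_endo_def)
    moreover have "norm (A + B' (\<omega> * r)) \<le> M + M" for r
      using norm_triangle_ineq[of A "B' (\<omega> * r)"] A bound[of "\<omega> * r"] by linarith
    ultimately obtain W where W: "W * X s = 1" "X s * W = 1"
      using solution_invertible[OF X] by blast
    have "blinfun_inv (Y s) = blinfun_of_endo W"
    proof (rule blinfun_inv_eqI)
      show "blinfun_of_endo W o\<^sub>L Y s = id_blinfun" "Y s o\<^sub>L blinfun_of_endo W = id_blinfun"
        using W[THEN arg_cong[of _ _ blinfun_of_endo]]
        by (simp_all add: X_def times_endo.rep_eq one_endo.rep_eq endo_of_blinfun_inverse)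
    qed
    then have "endo_of_blinfun (evolution_operator Y t s) = X t * W"
      by (simp add: evolution_operator_def X_def blinfun_of_endo_inverse flip: times_endo.abs_eq)
    then have "norm (evolution_operator Y t s) = norm (X t * W)"
      by (metis norm_endo.abs_eq)
    \<comment> \<open>\<open>X r * W\<close> solves the same equation and equals 1 at
      \<open>r = s\<close>, so the last factor is 1.\<close>
    also have "\<dots> \<le> K * exp (- \<alpha> * (t - s)) * norm (X s * W)"
    proof (rule decay[OF \<omega> _ st])
      show "((\<lambda>r. X r * W) has_vector_derivative (A + B' (\<omega> * r)) * (X r * W)) (at r)" for r
        using has_vector_derivative_mult[OF X[of r] has_vector_derivative_const[of W]]
        by (simp add: mult.assoc)
    qed
    finally show ?thesis
      by (simp add: W)
  qed
  with pos show ?thesis by blast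
qed

end
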